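(* Let $d\ge 4$, let $\Sigma\subseteq\mathbb{C}^d$ be an even-dimensional subspace with $\dim\Sigma\ge 4$ (possibly $\Sigma=\mathbb{C}^d$ when $d$ is even), and let $U$ be an antisymmetric operator on $\mathbb{C}^d$ that is unitary on $\Sigma$ and zero on $\Sigma^\perp$. For $(x,y)\in[0,1]\times[0,1]$ let $\chi^U_{x,y}:M_d\to M_d$ be the positive map $$\chi^U_{x,y}(X)=\mathrm{Tr}(X)\,\mathbb{I}_d - yX - x\,UX^TU^*.$$ If $x+y>7/4$, then $\chi^U_{x,y}$ is atomic.
   Context: $M_d$ is the algebra of $d\times d$ complex matrices (operators on $\mathbb{C}^d$), $M_d^+$ its cone of positive semidefinite elements, $\mathbb{I}_d$ the identity, $X^*$ the adjoint. Transposition $X\mapsto X^T$ is taken with respect to an orthonormal basis $(e_1,\dots,e_d)$ of $\mathbb{C}^d$ such that $\Sigma=\mathrm{span}(e_1,\dots,e_{2k})$, where $2k=\dim\Sigma$. "$U$ is antisymmetric, unitary on $\Sigma$ and zero on $\Sigma^\perp$" means: $U$ maps $\Sigma$ unitarily onto $\Sigma$, $U|_{\Sigma^\perp}=0$, and $U^T=-U$. Let $\tau(X)=X^T$. The Schmidt number $\mathrm{SN}(\rho)$ of $\rho\in (M_d\otimes M_d)^+$ is the smallest $r$ such that $\rho$ is a sum of operators $|\psi\rangle\langle\psi|$ with $\psi\in\mathbb{C}^d\otimes\mathbb{C}^d$ of Schmidt rank at most $r$. Put $\mathrm{V}_k=\{\rho\in (M_d\otimes M_d)^+ : \mathrm{SN}(\rho)\le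 k\}$ and $\mathrm{V}^k=(\mathrm{id}\otimes\tau)\mathrm{V}_k$. A linear map $\varphi:M_d\to M_d$ is positive if $\varphi(M_d^+)\subseteq M_d^+$; it is $k$-positive if $(\mathrm{id}\otimes\varphi)(\mathrm{V}_k)\subseteq (M_d\otimes M_d)^+$, and $k$-copositive if $(\mathrm{id}\otimes\varphi)(\mathrm{V}^k)\subseteq (M_d\otimes M_d)^+$ (equivalently, $\varphi\circ\tau$ is $k$-positive). $\mathrm{P}_k$ and $\mathrm{P}^k$ denote the convex cones of $k$-positive and $k$-copositive maps. A map $\varphi$ is atomic if it is positive and $\varphi\notin \mathrm{P}_2+\mathrm{P}^2$. *)

theory Defs
  imports "HOL-Analysis.Analysis"
begin

text \<open>
  Operators on \<open>\<complex>\<^sup>d\<close> are matrices of type \<open>complex^'n^'n\<close> with \<open>d = CARD('n)\<close>, and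
  \<open>M\<^sub>d \<otimes> M\<^sub>d\<close> is the type \<open>complex^('n \<times> 'n)^('n \<times> 'n)\<close>, the first component of an index
  belonging to the first tensor factor.
\<close>

text \<open>Conjugate-linear in the first argument.\<close>

definition cinner :: "complex^'n \<Rightarrow> complex^'n \<Rightarrow> complex" where
  "cinner v w = (\<Sum>i\<in>UNIV. cnj (v $ i) * w $ i)"

definition orthonormal_on :: "'i set \<Rightarrow> ('i \<Rightarrow> complex^'n) \<Rightarrow> bool" where
  "orthonormal_on I u \<longleftrightarrow> (\<forall>i\<in>I. \<forall>j\<in>I. cinner (u i) (u j) = (if i = j then 1 else 0))"

definition mscale :: "complex \<Rightarrow> complex^'n^'m \<Rightarrow> complex^'n^'m" where
  "mscale c A = map_matrix ((*) c) A"

definition adjoint_mat :: "complex^'n^'m \<Rightarrow> complex^'m^'n" where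
  "adjoint_mat A = map_matrix cnj (transpose A)"

text \<open>The operator \<open>|v\<rangle>\<langle>w|\<close>.\<close>

definition outer :: "complex^'m \<Rightarrow> complex^'n \<Rightarrow> complex^'n^'m" where
  "outer v w = (\<chi> i j. v $ i * cnj (w $ j))"

text \<open>Over \<open>\<complex>\<close> this condition includes that \<open>A\<close> is Hermitian.\<close>

definition psd :: "complex^'n^'n \<Rightarrow> bool" where
  "psd A \<longleftrightarrow> (\<forall>v. cinner v (A *v v) \<in> \<real>\<^sub>\<ge>\<^sub>0)"

text \<open>
  Transposition with respect to an orthonormal basis \<open>e\<close>, indexed by the \<open>d\<close>-element type
  \<open>'n\<close>: the \<open>(i, j)\<close> matrix element \<open>\<langle>e\<^sub>i, X\<^sup>T e\<^sub>j\<rangle>\<close> is \<open>\<langle>e\<^sub>j, X e\<^sub>i\<rangle>\<close>.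
\<close>

definition basis_transpose :: "('n \<Rightarrow> complex^'n) \<Rightarrow> complex^'n^'n \<Rightarrow> complex^'n^'n" where
  "basis_transpose e X = (\<Sum>i\<in>UNIV. \<Sum>j\<in>UNIV. mscale (cinner (e j) (X *v e i)) (outer (e i) (e j)))"

definition tensor_vec :: "complex^'n \<Rightarrow> complex^'n \<Rightarrow> complex^('n \<times> 'n)" where
  "tensor_vec u v = (\<chi> p. u $ fst p * v $ snd p)"

definition tensor_mat :: "complex^'n^'n \<Rightarrow> complex^'n^'n \<Rightarrow> complex^('n \<times> 'n)^('n \<times> 'n)" where
  "tensor_mat A B = (\<chi> p q. A $ fst p $ fst q * B $ snd p $ snd q)"

text \<open>
  \<open>id \<otimes> \<phi>\<close> applies \<open>\<phi>\<close> to each \<open>d \<times> d\<close> block of a matrix in \<open>M\<^sub>d \<otimes> M\<^sub>d\<close>; it is only used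
  for linear \<open>\<phi>\<close>.
\<close>

definition id_tensor ::
  "(complex^'n^'n \<Rightarrow> complex^'n^'n) \<Rightarrow> complex^('n \<times> 'n)^('n \<times> 'n) \<Rightarrow> complex^('n \<times> 'n)^('n \<times> 'n)"
  where
  "id_tensor \<phi> \<rho> = (\<chi> p q. \<phi> (\<chi> a b. \<rho> $ (fst p, a) $ (fst q, b)) $ snd p $ snd q)"

text \<open>
  The number of terms of a Schmidt decomposition
  \<open>\<psi> = (\<Sum>s<r. c\<^sub>s u\<^sub>s \<otimes> v\<^sub>s)\<close>, \<open>c\<^sub>s > 0\<close>; it is the same for all Schmidt decompositions of \<open>\<psi>\<close>.
\<close>

definition schmidt_rank :: "complex^('n::finite \<times> 'n) \<Rightarrow> nat" where
  "schmidt_rank \<psi> = (LEAST r. \<exists>(c :: nat \<Rightarrow> real) u v.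
     (\<forall>s<r. c s > 0) \<and> orthonormal_on {..<r} u \<and> orthonormal_on {..<r} v \<and>
     \<psi> = (\<Sum>s<r. c s *\<^sub>R tensor_vec (u s) (v s)))"

text \<open>Meaningful for positive semidefinite \<open>\<rho>\<close>, for which such a sum exists.\<close>

definition schmidt_number :: "complex^('n::finite \<times> 'n)^('n \<times> 'n) \<Rightarrow> nat" where
  "schmidt_number \<rho> = (LEAST r. \<exists>N (\<psi> :: nat \<Rightarrow> complex^('n \<times> 'n)).
     (\<forall>i<N. schmidt_rank (\<psi> i) \<le> r) \<and> \<rho> = (\<Sum>i<N. outer (\<psi> i) (\<psi> i)))"

definition V_sub :: "nat \<Rightarrow> (complex^('n::finite \<times> 'n)^('n \<times> 'n)) set" where
  "V_sub k = {\<rho>. psd \<rho> \<and> schmidt_number \<rho> \<le> k}"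

definition V_sup :: "('n \<Rightarrow> complex^'n) \<Rightarrow> nat \<Rightarrow> (complex^('n \<times> 'n)^('n \<times> 'n)) set" where
  "V_sup e k = id_tensor (basis_transpose e) ` V_sub k"

abbreviation clinear_map :: "(complex^'n^'n \<Rightarrow> complex^'n^'n) \<Rightarrow> bool" where
  "clinear_map \<equiv> Vector_Spaces.linear mscale mscale"

definition positive_map :: "(complex^'n^'n \<Rightarrow> complex^'n^'n) \<Rightarrow> bool" where
  "positive_map \<phi> \<longleftrightarrow> clinear_map \<phi> \<and> (\<forall>X. psd X \<longrightarrow> psd (\<phi> X))"

definition P_sub :: "nat \<Rightarrow> (complex^'n^'n \<Rightarrow> complex^'n^'n) set" where
  "P_sub k = {\<phi>. clinear_map \<phi> \<and> (\<forall>\<rho>\<in>V_sub k. psd (id_tensor \<phi> \<rho>))}"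

definition P_sup :: "('n \<Rightarrow> complex^'n) \<Rightarrow> nat \<Rightarrow> (complex^'n^'n \<Rightarrow> complex^'n^'n) set" where
  "P_sup e k = {\<phi>. clinear_map \<phi> \<and> (\<forall>\<rho>\<in>V_sup e k. psd (id_tensor \<phi> \<rho>))}"

definition atomic_map ::
  "('n \<Rightarrow> complex^'n) \<Rightarrow> (complex^'n^'n \<Rightarrow> complex^'n^'n) \<Rightarrow> bool" where
  "atomic_map e \<phi> \<longleftrightarrow> positive_map \<phi> \<and>
     \<phi> \<notin> {\<lambda>X. \<phi>\<^sub>1 X + \<phi>\<^sub>2 X | \<phi>\<^sub>1 \<phi>\<^sub>2. \<phi>\<^sub>1 \<in> P_sub 2 \<and> \<phi>\<^sub>2 \<in> P_sup e 2}"

definition unitary_on :: "(complex^'n) set \<Rightarrow> complex^'n^'n \<Rightarrow> bool" where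
  "unitary_on \<Sigma> U \<longleftrightarrow> (*v) U ` \<Sigma> = \<Sigma> \<and>
     (\<forall>v\<in>\<Sigma>. \<forall>w\<in>\<Sigma>. cinner (U *v v) (U *v w) = cinner v w)"

definition zero_on_orthogonal :: "(complex^'n) set \<Rightarrow> complex^'n^'n \<Rightarrow> bool" where
  "zero_on_orthogonal \<Sigma> U \<longleftrightarrow> (\<forall>v. (\<forall>w\<in>\<Sigma>. cinner w v = 0) \<longrightarrow> U *v v = 0)"

definition chi_map ::
  "('n \<Rightarrow> complex^'n) \<Rightarrow> complex^'n^'n \<Rightarrow> real \<Rightarrow> real \<Rightarrow> complex^'n^'n \<Rightarrow> complex^'n^'n" where
  "chi_map e U x y X =
     mscale (trace X) (mat 1) - y *\<^sub>R X - x *\<^sub>R (U ** basis_transpose e X ** adjoint_mat U)"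

lemma vector_space_mscale: "vector_space (mscale :: complex \<Rightarrow> complex^'n^'m \<Rightarrow> _)"
  by unfold_locales (simp_all add: mscale_def vec_eq_iff algebra_simps)

lemma basis_transpose_standard: "basis_transpose (\<lambda>i. axis i 1) X = transpose X"
proof -
  have col: "(X *v axis i 1) $ k = X $ k $ i" for i k
  proof -
    have "(X *v axis i 1) $ k = (\<Sum>l\<in>UNIV. if l = i then X $ k $ l else 0)"
      unfolding matrix_vector_mult_def vec_lambda_beta
      by (intro sum.cong refl) (auto simp: axis_def)
    then show ?thesis by simp
  qed
  have *: "cinner (axis j 1) (X *v axis i 1) = X $ j $ i" for i j
  proof -
    have "cinner (axis j 1) (X *v axis i 1) = (\<Sum>k\<in>UNIV. if k = j then X $ k $ i else 0)"
      unfolding cinner_def col by (intro sum.cong refl) (auto simp: axis_def)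
    then show ?thesis by simp
  qed
  have "(\<Sum>i\<in>UNIV. \<Sum>j\<in>UNIV. X $ j $ i * (axis i 1 $ a * cnj (axis j 1 $ b))) = X $ b $ a" for a b
  proof -
    have "(\<Sum>i\<in>UNIV. \<Sum>j\<in>UNIV. X $ j $ i * (axis i 1 $ a * cnj (axis j 1 $ b))) =
          (\<Sum>i\<in>UNIV. \<Sum>j\<in>UNIV. if j = b then (if i = a then X $ j $ i else 0) else 0)"
      by (intro sum.cong refl) (auto simp: axis_def)
    then show ?thesis by simp
  qed
  then show ?thesis
    by (simp add: basis_transpose_def * vec_eq_iff transpose_def mscale_def outer_def)
qed

lemma id_tensor_tensor_mat:
  assumes "clinear_map \<phi>"
  shows "id_tensor \<phi> (tensor_mat A B) = tensor_mat A (\<phi> B)"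
proof -
  interpret Vector_Spaces.linear mscale mscale \<phi> by (fact assms)
  have "(\<chi> a b. tensor_mat A B $ (i, a) $ (j, b)) = mscale (A $ i $ j) B" for i j
    by (simp add: tensor_mat_def mscale_def vec_eq_iff)
  then show ?thesis
    by (simp add: id_tensor_def scale vec_eq_iff tensor_mat_def) (simp add: mscale_def)
qed

end

theory Submission
  imports Defs
begin

text \<open>
  Let \<open>K\<close> be complex conjugation in the basis \<open>e\<close> and \<open>\<theta> = U K\<close>. Antisymmetry of \<open>U\<close> gives
  \<open>\<langle>a, \<theta> b\<rangle> = - \<langle>b, \<theta> a\<rangle>\<close>. For positivity, \<open>\<langle>v, U X\<^sup>T U\<^sup>* v\<rangle> = \<langle>\<theta> v, X \<theta> v\<rangle>\<close> with
  \<open>\<theta> v\<close> orthogonal to \<open>v\<close> and no longer than \<open>v\<close>, so the two subtracted terms are dominated by the trace.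

  For atomicity, choose an orthonormal family \<open>v\<^sub>0, v\<^sub>1 = \<theta> v\<^sub>0, v\<^sub>2, v\<^sub>3 = \<theta> v\<^sub>2\<close> in \<open>\<Sigma>\<close>. There is a
  state \<open>\<rho>\<close> on its span such that both \<open>\<rho>\<close> and its partial transpose are explicit sums of projections
  onto vectors of Schmidt rank at most two. Hence, for
  \<open>\<Omega> = (\<Sum>i. v\<^sub>i \<otimes> v\<^sub>i)\<close>, every \<open>\<phi>\<close> in \<open>P\<^sub>2 + P\<^sup>2\<close> satisfies \<open>\<langle>\<Omega>, (id \<otimes> \<phi>)(\<rho>) \<Omega>\<rangle> \<ge> 0\<close>, whereas
  this expectation equals \<open>24 - 16 (x + y)\<close> for \<open>\<chi>\<close>, which is negative already for \<open>x + y > 3/2\<close>.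
\<close>

section \<open>The inner product\<close>

lemma cinner_add_left: "cinner (u + v) w = cinner u w + cinner v w"
  by (simp add: cinner_def algebra_simps sum.distrib)

lemma cinner_add_right: "cinner u (v + w) = cinner u v + cinner u w"
  by (simp add: cinner_def algebra_simps sum.distrib)

lemma cinner_minus_left [simp]: "cinner (- u) w = - cinner u w"
  by (simp add: cinner_def sum_negf)

lemma cinner_minus_right [simp]: "cinner u (- w) = - cinner u w"
  by (simp add: cinner_def sum_negf)

lemma cinner_diff_right: "cinner u (v - w) = cinner u v - cinner u w"
  by (simp add: cinner_def algebra_simps sum_subtractf)

lemma cinner_zero_left [simp]: "cinner 0 w = 0"
  by (simp add: cinner_def)

lemma cinner_zero_right [simp]: "cinner w 0 = 0"
  by (simp add: cinner_def)

lemma cinner_scale_left [simp]: "cinner (c *s v) w = cnj c * cinner v w"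
  by (simp add: cinner_def sum_distrib_left mult.assoc)

lemma cinner_scale_right [simp]: "cinner v (c *s w) = c * cinner v w"
  by (simp add: cinner_def sum_distrib_left mult_ac)

lemma cinner_sum_left: "cinner (\<Sum>i\<in>I. f i) w = (\<Sum>i\<in>I. cinner (f i) w)"
  by (induction I rule: infinite_finite_induct) (simp_all add: cinner_add_left)

lemma cinner_sum_right: "cinner v (\<Sum>i\<in>I. f i) = (\<Sum>i\<in>I. cinner v (f i))"
  by (induction I rule: infinite_finite_induct) (simp_all add: cinner_add_right)

lemma cnj_cinner: "cnj (cinner v w) = cinner w v"
  by (simp add: cinner_def mult.commute)

lemma cinner_self: "cinner v v = complex_of_real ((norm v)\<^sup>2)"
proof -
  have "(norm v)\<^sup>2 = (\<Sum>i\<in>UNIV. (cmod (v $ i))\<^sup>2)"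
    by (simp add: norm_vec_def L2_set_def sum_nonneg)
  then show ?thesis
    by (simp add: cinner_def complex_norm_square mult.commute del: of_real_power)
qed

lemma cinner_adjoint: "cinner v (M *v w) = cinner (adjoint_mat M *v v) w"
  by (simp add: cinner_def adjoint_mat_def matrix_vector_mult_def map_matrix_def transpose_def
      sum_distrib_left sum_distrib_right mult_ac) (rule sum.swap)

lemma cinner_normalize:
  assumes "v \<noteq> 0"
  defines "c \<equiv> complex_of_real (inverse (norm v))"
  shows "cinner (c *s v) (c *s v) = 1"
proof -
  have "cinner (c *s v) (c *s v) = cnj c * (c * cinner v v)"
    by simp
  also have "\<dots> = 1"
    unfolding cinner_self using assms(1) by (simp add: c_def power2_eq_square field_simps)
  finally show ?thesis .
qed

lemma adjoint_adjoint [simp]: "adjoint_mat (adjoint_mat M) = M"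
  by (simp add: adjoint_mat_def map_matrix_def transpose_def vec_eq_iff)

lemma matrix_vector_mult_uminus: "M *v (- v) = - (M *v (v :: complex^'n))"
  by (simp add: matrix_vector_mult_def vec_eq_iff sum_negf)

lemma uminus_matrix_vector_mult: "(- M) *v v = - (M *v (v :: complex^'n))"
  by (simp add: matrix_vector_mult_def vec_eq_iff sum_negf)

lemma matrix_vector_mult_sum: "M *v (\<Sum>i\<in>I. f i) = (\<Sum>i\<in>I. M *v (f i :: complex^'n))"
  by (induction I rule: infinite_finite_induct) (simp_all add: matrix_vector_right_distrib)

lemma sum_matrix_vector_mult: "(\<Sum>i\<in>I. M i) *v (v :: complex^'n) = (\<Sum>i\<in>I. M i *v v)"
  by (induction I rule: infinite_finite_induct) (simp_all add: matrix_vector_mult_add_rdistrib)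

section \<open>Rank one operators and positivity\<close>

lemma outer_mult_vec: "outer a b *v v = cinner b v *s a"
  by (simp add: outer_def cinner_def matrix_vector_mult_def vec_eq_iff sum_distrib_left mult_ac)

lemma outer_minus_left: "outer (- a) b = - outer a b"
  by (simp add: outer_def vec_eq_iff)

lemma outer_minus_right: "outer a (- b) = - outer a b"
  by (simp add: outer_def vec_eq_iff)

lemma outer_add_left: "outer (a + b) c = outer a c + outer b c"
  by (simp add: outer_def vec_eq_iff algebra_simps)

lemma outer_add_right: "outer a (b + c) = outer a b + outer a c"
  by (simp add: outer_def vec_eq_iff algebra_simps)

lemma trace_outer: "trace (outer a b) = cinner b a"
  by (simp add: trace_def outer_def cinner_def mult.commute)

lemma mult_outer: "M ** outer a b = outer (M *v a) b"
  by (simp add: outer_def matrix_matrix_mult_def matrix_vector_mult_def vec_eq_iff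
      sum_distrib_right mult.assoc)

lemma outer_mult_adjoint: "outer a b ** adjoint_mat M = outer a (M *v b)"
  by (simp add: outer_def matrix_matrix_mult_def matrix_vector_mult_def vec_eq_iff adjoint_mat_def
      map_matrix_def transpose_def sum_distrib_left mult_ac)

lemma mscale_mult_vec: "mscale c A *v v = c *s (A *v v)"
  by (simp add: mscale_def map_matrix_def matrix_vector_mult_def vec_eq_iff sum_distrib_left mult_ac)

lemma scaleR_mult_vec: "(r *\<^sub>R A) *v v = complex_of_real r *s (A *v (v :: complex^'n))"
  by (simp add: matrix_vector_mult_def vec_eq_iff sum_distrib_left mult_ac)
     (simp add: scaleR_conv_of_real mult_ac)

lemma psd_outer: "psd (outer v v)"
proof -
  have "cinner u (outer v v *v u) = complex_of_real ((cmod (cinner v u))\<^sup>2)" for u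
    by (subst complex_norm_square) (simp add: outer_mult_vec cnj_cinner)
  then show ?thesis
    unfolding psd_def by (simp del: of_real_power)
qed

lemma psd_add: "psd A \<Longrightarrow> psd B \<Longrightarrow> psd (A + B)"
  by (simp add: psd_def matrix_vector_mult_add_rdistrib cinner_add_right)

lemma psd_zero: "psd 0"
  by (simp add: psd_def)

lemma psd_sum: "(\<And>i. i \<in> I \<Longrightarrow> psd (A i)) \<Longrightarrow> psd (\<Sum>i\<in>I. A i)"
  by (induction I rule: infinite_finite_induct) (simp_all add: psd_zero psd_add)

lemma trace_nonneg:
  assumes "psd X"
  shows "trace X \<in> \<real>\<^sub>\<ge>\<^sub>0"
proof -
  have "cinner (axis i 1) (X *v axis i 1) = X $ i $ i" for i
  proof -
    have "cinner (axis i 1) (X *v axis i 1) = (\<Sum>k\<in>UNIV. if k = i then (X *v axis i 1) $ k else 0)"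
      unfolding cinner_def by (intro sum.cong refl) (auto simp: axis_def)
    then have "cinner (axis i 1) (X *v axis i 1) = (X *v axis i 1) $ i"
      by simp
    then show ?thesis
      by (simp add: matrix_vector_mult_def axis_def if_distrib [of "(*) _"] cong: if_cong)
  qed
  then have "trace X = (\<Sum>i\<in>UNIV. cinner (axis i 1) (X *v axis i 1))"
    by (simp add: trace_def)
  then show ?thesis
    using assms by (simp add: psd_def complex_nonneg_Reals_iff sum_nonneg)
qed

lemma psd_congruence:
  assumes "psd X"
  shows "psd (adjoint_mat Q ** X ** Q)"
proof -
  have "cinner v ((adjoint_mat Q ** X ** Q) *v v) = cinner (Q *v v) (X *v (Q *v v))" for v
    by (simp add: matrix_vector_mul_assoc [symmetric] cinner_adjoint [of v])
  then show ?thesis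
    using assms by (simp add: psd_def)
qed

lemma trace_mult_outer: "trace (X ** outer a b) = cinner b (X *v a)"
  by (simp add: mult_outer trace_outer)

text \<open>With \<open>P\<close> the projection onto the span of the family and
  \<open>Q = mat 1 - P\<close>, the difference of the two sides is the trace of
  \<open>Q ** X ** Q\<close>, by cyclicity and \<open>Q ** Q = Q\<close>. That matrix is positive
  semidefinite, so its trace is nonnegative.\<close>

lemma trace_ge_orthonormal_sum:
  assumes "psd X" and "finite I" and "orthonormal_on I u"
  shows "(\<Sum>i\<in>I. Re (cinner (u i) (X *v u i))) \<le> Re (trace X)"
proof -
  define P where "P = (\<Sum>i\<in>I. outer (u i) (u i))"
  have P: "P *v v = (\<Sum>i\<in>I. cinner (u i) v *s u i)" for v
    by (simp add: P_def sum_matrix_vector_mult outer_mult_vec)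
  have "P *v (P *v v) = P *v v" for v
  proof -
    have "cinner (u i) (P *v v) = cinner (u i) v" if "i \<in> I" for i
    proof -
      have "cinner (u i) (P *v v) = (\<Sum>j\<in>I. cinner (u j) v * (if i = j then 1 else 0))"
        unfolding P cinner_sum_right
        using assms(3) that by (intro sum.cong refl) (simp add: orthonormal_on_def)
      also have "\<dots> = cinner (u i) v"
        using that assms(2) by (simp add: if_distrib [of "(*) _"] cong: if_cong)
      finally show ?thesis .
    qed
    then have "(\<Sum>i\<in>I. cinner (u i) (P *v v) *s u i) = P *v v"
      unfolding P [of v] by (intro sum.cong refl) simp
    then show ?thesis
      by (simp only: P [of "P *v v"])
  qed
  then have PP: "P ** P = P"
    by (simp add: matrix_eq matrix_vector_mul_assoc)
  have adj: "adjoint_mat P = P"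
    by (simp add: P_def adjoint_mat_def map_matrix_def transpose_def outer_def vec_eq_iff mult.commute)
  define Q where "Q = mat 1 - P"
  have Q: "adjoint_mat Q = Q"
  proof -
    have "adjoint_mat Q = adjoint_mat (mat 1) - adjoint_mat P"
      by (simp add: Q_def adjoint_mat_def map_matrix_def transpose_def vec_eq_iff)
    also have "adjoint_mat (mat 1) = mat 1"
      by (simp add: adjoint_mat_def map_matrix_def transpose_def mat_def vec_eq_iff)
    finally show ?thesis
      by (simp add: adj Q_def)
  qed
  have QQ: "Q ** Q = Q"
    by (simp add: Q_def matrix_eq matrix_vector_mul_assoc [symmetric] matrix_vector_mult_diff_rdistrib
        matrix_vector_mult_diff_distrib) (simp add: matrix_vector_mul_assoc PP)
  have "trace (adjoint_mat Q ** X ** Q) = trace (X ** Q)"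
  proof -
    have "trace (adjoint_mat Q ** X ** Q) = trace (Q ** (X ** Q))"
      by (simp add: Q matrix_mul_assoc)
    also have "\<dots> = trace (X ** (Q ** Q))"
      by (subst trace_mul_sym) (simp add: matrix_mul_assoc)
    finally show ?thesis
      by (simp add: QQ)
  qed
  also have "X ** Q = X - (\<Sum>i\<in>I. X ** outer (u i) (u i))"
    by (simp add: Q_def P_def matrix_eq matrix_vector_mul_assoc [symmetric]
        matrix_vector_mult_diff_rdistrib matrix_vector_mult_diff_distrib sum_matrix_vector_mult
        matrix_vector_mult_sum)
  also have "trace \<dots> = trace X - (\<Sum>i\<in>I. cinner (u i) (X *v u i))"
  proof -
    have "trace (\<Sum>i\<in>I. X ** outer (u i) (u i)) = (\<Sum>i\<in>I. trace (X ** outer (u i) (u i)))"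
      by (induction I rule: infinite_finite_induct) (simp_all add: trace_def sum.distrib)
    then show ?thesis
      by (simp add: trace_sub trace_mult_outer)
  qed
  finally show ?thesis
    using trace_nonneg [OF psd_congruence [OF assms(1), of Q]]
    by (simp add: complex_nonneg_Reals_iff)
qed

text \<open>Normalizing \<open>v\<close> and \<open>m\<close> gives an orthonormal pair, to which
  \<open>trace_ge_orthonormal_sum\<close> applies. Scaling back by \<open>(norm v)\<^sup>2\<close>
  overestimates the weight of \<open>m\<close>, which is harmless for a nonnegative term. For
  positivity of \<open>chi_map\<close>, \<open>m\<close> is \<theta> v.\<close>

lemma norm_square_trace_ge:
  fixes v m :: "complex^'n"
  assumes X: "psd X" and orth: "cinner v m = 0" and le: "norm m \<le> norm v"
  shows "Re (cinner v (X *v v)) + Re (cinner m (X *v m)) \<le> (norm v)\<^sup>2 * Re (trace X)"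
proof (cases "v = 0")
  case True
  then show ?thesis using le by simp
next
  case False
  define c where "c w = complex_of_real (inverse (norm w))" for w :: "complex^'n"
  have scaled: "(norm w)\<^sup>2 * Re (cinner (c w *s w) (X *v (c w *s w))) = Re (cinner w (X *v w))"
    if "w \<noteq> 0" for w
    using that by (simp add: c_def vector_scalar_commute power2_eq_square)
  have unit: "cinner (c w *s w) (c w *s w) = 1" if "w \<noteq> 0" for w
    using that unfolding c_def by (rule cinner_normalize)
  have nonneg: "Re (cinner w (X *v w)) \<ge> 0" for w
    using X by (auto simp: psd_def complex_nonneg_Reals_iff)
  \<comment> \<open>Boolean indices let one family serve both cases: only \<open>True\<close> is
    used if \<open>m = 0\<close>, which cannot be normalized.\<close>
  define u where "u b = (if b then c v *s v else c m *s m)" for b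
  have u: "u True = c v *s v" "u False = c m *s m"
    by (simp_all add: u_def)
  have orth': "cinner m v = 0"
    using cnj_cinner [of v m] orth by simp
  show ?thesis
  proof (cases "m = 0")
    case True
    have "orthonormal_on {True} u"
      using unit False by (simp add: orthonormal_on_def u_def)
    from trace_ge_orthonormal_sum [OF X _ this]
    have "Re (cinner (c v *s v) (X *v (c v *s v))) \<le> Re (trace X)"
      by (simp add: u del: cinner_scale_left cinner_scale_right)
    from mult_left_mono [OF this, of "(norm v)\<^sup>2"] show ?thesis
      by (simp add: scaled False True del: cinner_scale_left cinner_scale_right)
  next
    case m: False
    have "orthonormal_on {True, False} u"
      using unit [OF False] unit [OF m] orth orth' by (auto simp: orthonormal_on_def u)
    from trace_ge_orthonormal_sum [OF X _ this]
    have le': "Re (cinner (c v *s v) (X *v (c v *s v))) + Re (cinner (c m *s m) (X *v (c m *s m)))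
        \<le> Re (trace X)"
      by (simp add: u del: cinner_scale_left cinner_scale_right)
    have "(norm m)\<^sup>2 * Re (cinner (c m *s m) (X *v (c m *s m)))
        \<le> (norm v)\<^sup>2 * Re (cinner (c m *s m) (X *v (c m *s m)))"
      by (intro mult_right_mono power_mono le nonneg norm_ge_zero)
    then show ?thesis
      using mult_left_mono [OF le' zero_le_power2 [of "norm v"]]
      unfolding distrib_left scaled [OF False] scaled [OF m] by linarith
  qed
qed

section \<open>Conjugation with respect to an orthonormal basis\<close>

text \<open>The antiunitary involution K. It allows transposition to be treated without coordinates,
  as K composed with the adjoint and K again.\<close>

definition basis_cnj :: "('n \<Rightarrow> complex^'n) \<Rightarrow> complex^'n \<Rightarrow> complex^'n" where
  "basis_cnj e v = (\<Sum>i\<in>UNIV. cnj (cinner (e i) v) *s e i)"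

lemma basis_cnj_minus [simp]: "basis_cnj e (- v) = - basis_cnj e v"
  by (simp add: basis_cnj_def sum_negf)

lemma basis_transpose_outer: "basis_transpose e (outer a b) = outer (basis_cnj e b) (basis_cnj e a)"
proof -
  have "basis_transpose e (outer a b) =
      (\<Sum>i\<in>UNIV. \<Sum>j\<in>UNIV. mscale (cinner b (e i) * cinner (e j) a) (outer (e i) (e j)))"
    by (simp add: basis_transpose_def outer_mult_vec)
  then show ?thesis
    by (simp add: basis_cnj_def cnj_cinner mscale_def outer_def map_matrix_def vec_eq_iff sum_product
        mult_ac)
qed

lemma clinear_basis_transpose: "clinear_map (basis_transpose e)"
  by (simp add: Vector_Spaces.linear_iff vector_space_mscale basis_transpose_def
      matrix_vector_mult_add_rdistrib cinner_add_right mscale_mult_vec)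
     (simp add: mscale_def vec_eq_iff algebra_simps sum.distrib sum_distrib_left)

context
  fixes e :: "'n::finite \<Rightarrow> complex^'n"
  assumes e: "orthonormal_on UNIV e"
begin

text \<open>The matrix \<open>W\<close> with columns \<open>e i\<close> is square, so its left
  inverse \<open>adjoint_mat W\<close> is also a right inverse: orthonormality implies
  completeness.\<close>

lemma basis_expansion: "(\<Sum>i\<in>UNIV. cinner (e i) v *s e i) = v"
proof -
  define W :: "complex^'n^'n" where "W = (\<chi> k i. e i $ k)"
  have "adjoint_mat W ** W = mat 1"
    using e by (simp add: W_def adjoint_mat_def map_matrix_def transpose_def matrix_matrix_mult_def
        mat_def vec_eq_iff orthonormal_on_def cinner_def)
  then have "W ** adjoint_mat W = mat 1"
    by (simp add: matrix_left_right_inverse)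
  then have "v = W *v (adjoint_mat W *v v)"
    by (simp add: matrix_vector_mul_assoc)
  also have "\<dots> = (\<Sum>i\<in>UNIV. cinner (e i) v *s e i)"
    by (simp add: W_def adjoint_mat_def map_matrix_def transpose_def matrix_vector_mult_def
        vec_eq_iff cinner_def mult.commute)
  finally show ?thesis by simp
qed

lemma cinner_basis_cnj: "cinner (e i) (basis_cnj e v) = cinner v (e i)"
proof -
  have "cinner (e i) (basis_cnj e v) = (\<Sum>j\<in>UNIV. cinner v (e j) * (if i = j then 1 else 0))"
    unfolding basis_cnj_def cinner_sum_right
    using e by (intro sum.cong refl) (simp add: orthonormal_on_def cnj_cinner)
  also have "\<dots> = cinner v (e i)"
    by (simp add: if_distrib [of "(*) _"] cong: if_cong)
  finally show ?thesis .
qed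

lemma parseval: "cinner v w = (\<Sum>i\<in>UNIV. cinner v (e i) * cinner (e i) w)"
  by (subst basis_expansion [of w, symmetric]) (simp add: cinner_sum_right mult.commute)

lemma basis_cnj_involution [simp]: "basis_cnj e (basis_cnj e v) = v"
  by (subst (2) basis_expansion [of v, symmetric])
     (simp add: basis_cnj_def [of e "basis_cnj e v"] cinner_basis_cnj cnj_cinner)

lemma cinner_basis_cnj_cnj: "cinner (basis_cnj e v) (basis_cnj e w) = cinner w v"
proof -
  have "cinner (basis_cnj e v) (e i) = cinner (e i) v" for i
    using cnj_cinner [of "e i" "basis_cnj e v"] by (simp add: cinner_basis_cnj cnj_cinner)
  then show ?thesis
    unfolding parseval [of "basis_cnj e v" "basis_cnj e w"] parseval [of w v]
    by (simp add: cinner_basis_cnj mult.commute)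
qed

lemma norm_basis_cnj: "norm (basis_cnj e v) = norm v"
proof -
  have "complex_of_real ((norm (basis_cnj e v))\<^sup>2) = complex_of_real ((norm v)\<^sup>2)"
    unfolding cinner_self [symmetric] by (rule cinner_basis_cnj_cnj)
  then show ?thesis
    by (simp only: of_real_eq_iff) simp
qed

lemma cinner_basis_cnj_swap: "cinner v (basis_cnj e w) = cinner w (basis_cnj e v)"
  using cinner_basis_cnj_cnj [of "basis_cnj e v" w] by simp

text \<open>Summing over \<open>j\<close> first collapses the coefficients to
  \<open>cinner (basis_cnj e v) (X *v e i)\<close>; moving \<open>X\<close> to the other side as its
  adjoint produces the coordinates of the conjugated vector.\<close>

lemma basis_transpose_mult_vec:
  "basis_transpose e X *v v = basis_cnj e (adjoint_mat X *v basis_cnj e v)"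
proof -
  have "basis_transpose e X *v v =
      (\<Sum>i\<in>UNIV. \<Sum>j\<in>UNIV. (cinner (e j) (X *v e i) * cinner (e j) v) *s e i)"
    by (simp add: basis_transpose_def sum_matrix_vector_mult mscale_mult_vec outer_mult_vec)
  also have "\<dots> = (\<Sum>i\<in>UNIV. cinner (basis_cnj e v) (X *v e i) *s e i)"
  proof (intro sum.cong refl)
    fix i
    have "cinner (basis_cnj e v) (X *v e i) = (\<Sum>j\<in>UNIV. cinner (e j) (X *v e i) * cinner (e j) v)"
      by (simp add: basis_cnj_def cinner_sum_left mult.commute)
    then show "(\<Sum>j\<in>UNIV. (cinner (e j) (X *v e i) * cinner (e j) v) *s e i) =
        cinner (basis_cnj e v) (X *v e i) *s e i"
      by (simp add: vec.scale_sum_left)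
  qed
  also have "\<dots> = basis_cnj e (adjoint_mat X *v basis_cnj e v)"
    by (simp add: basis_cnj_def [of e "adjoint_mat X *v _"] cnj_cinner cinner_adjoint)
  finally show ?thesis .
qed

lemma basis_cnj_adjoint:
  assumes "basis_transpose e U = - U"
  shows "basis_cnj e (adjoint_mat U *v v) = - (U *v basis_cnj e v)"
  using basis_transpose_mult_vec [of U "basis_cnj e v"]
  by (simp add: assms uminus_matrix_vector_mult)

text \<open>Antisymmetry of \<open>U\<close> replaces U K by minus K times the adjoint of
  \<open>U\<close>; symmetry of the form \<open>cinner v (basis_cnj e w)\<close> then exchanges
  \<open>a\<close> and \<open>b\<close>. For \<open>a = b\<close> it shows that \<theta> a is
  orthogonal to \<open>a\<close>.\<close>

lemma cinner_antisymmetric: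
  assumes "basis_transpose e U = - U"
  shows "cinner a (U *v basis_cnj e b) = - cinner b (U *v basis_cnj e a)"
proof -
  have "cinner a (U *v basis_cnj e b) = - cinner a (basis_cnj e (adjoint_mat U *v b))"
    by (simp add: basis_cnj_adjoint [OF assms])
  also have "\<dots> = - cinner (adjoint_mat U *v b) (basis_cnj e a)"
    by (simp only: cinner_basis_cnj_swap [of a])
  also have "\<dots> = - cinner b (U *v basis_cnj e a)"
    by (simp only: cinner_adjoint)
  finally show ?thesis .
qed

end

section \<open>The map \<open>\<chi>\<close>\<close>

lemma clinear_chi_map: "clinear_map (chi_map e U x y)"
proof -
  interpret T: Vector_Spaces.linear mscale mscale "basis_transpose e"
    by (rule clinear_basis_transpose)
  have assoc: "M ** (A + B) ** N = M ** A ** N + M ** B ** N" for M A B N :: "complex^'n^'n"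
    by (simp add: matrix_add_ldistrib matrix_eq matrix_vector_mul_assoc [symmetric]
        matrix_vector_mult_add_rdistrib matrix_vector_right_distrib)
  have scale: "M ** mscale c A ** N = mscale c (M ** A ** N)" for M A N :: "complex^'n^'n" and c
    by (simp add: matrix_eq matrix_vector_mul_assoc [symmetric] mscale_mult_vec vector_scalar_commute)
  have tr: "trace (mscale c A) = c * trace A" for A :: "complex^'n^'n" and c
    by (simp add: trace_def mscale_def sum_distrib_left)
  show ?thesis
    by (simp add: Vector_Spaces.linear_iff vector_space_mscale chi_map_def T.add T.scale assoc scale
        trace_add tr)
       (simp add: mscale_def vec_eq_iff algebra_simps)
qed

text \<open>Transposition swaps and conjugates the two vectors of a rank one operator, so the last
  term of \<chi> sends \<open>outer a b\<close> to the rank one operator of \<theta> b and \<theta>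
  a.\<close>

lemma cinner_chi_map_outer:
  "cinner u (chi_map e U x y (outer a b) *v v) =
    cinner b a * cinner u v - y * (cinner u a * cinner b v) -
    x * (cinner u (U *v basis_cnj e b) * cinner (U *v basis_cnj e a) v)"
  by (simp add: chi_map_def basis_transpose_outer mult_outer outer_mult_adjoint trace_outer
      matrix_vector_mult_diff_rdistrib cinner_diff_right mscale_mult_vec scaleR_mult_vec
      outer_mult_vec mult_ac)

lemma positive_chi_map:
  assumes e: "orthonormal_on UNIV e"
    and U: "basis_transpose e U = - U" and contr: "\<And>v. norm (U *v v) \<le> norm v"
    and "x \<in> {0..1}" and "y \<in> {0..1}"
  shows "positive_map (chi_map e U x y)"
proof -
  have orth: "cinner v (U *v basis_cnj e v) = 0" for v
    using cinner_antisymmetric [OF e U, of v v] by simp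
  have "psd (chi_map e U x y X)" if X: "psd X" for X
    unfolding psd_def
  proof
    fix v
    define m where "m = U *v basis_cnj e v"
    \<comment> \<open>Conjugating \<open>adjoint_mat U *v v\<close> gives \<open>- m\<close>; the
      sign disappears in the quadratic form.\<close>
    have "cinner v ((U ** basis_transpose e X ** adjoint_mat U) *v v) =
        cinner (adjoint_mat U *v v) (basis_transpose e X *v (adjoint_mat U *v v))"
      by (simp add: matrix_vector_mul_assoc [symmetric] cinner_adjoint)
    also have "\<dots> = cinner (adjoint_mat X *v basis_cnj e (adjoint_mat U *v v))
        (basis_cnj e (adjoint_mat U *v v))"
      by (simp add: basis_transpose_mult_vec [OF e] cinner_basis_cnj_swap [OF e, of "adjoint_mat U *v v"])
    also have "\<dots> = cinner m (X *v m)"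
      by (simp add: cinner_adjoint [symmetric] basis_cnj_adjoint [OF e U] m_def matrix_vector_mult_uminus)
    finally have chi: "cinner v (chi_map e U x y X *v v) =
        trace X * (norm v)\<^sup>2 - y * cinner v (X *v v) - x * cinner m (X *v m)"
      by (simp add: chi_map_def matrix_vector_mult_diff_rdistrib cinner_diff_right mscale_mult_vec
          scaleR_mult_vec cinner_self)
    have real: "cinner w (X *v w) = of_real (Re (cinner w (X *v w)))"
      and nonneg: "Re (cinner w (X *v w)) \<ge> 0" for w
      using X by (auto simp: psd_def complex_nonneg_Reals_iff complex_eq_iff)
    have real_tr: "trace X = of_real (Re (trace X))"
      using trace_nonneg [OF X] by (simp add: complex_nonneg_Reals_iff complex_eq_iff)
    have "norm m \<le> norm v"
      using contr [of "basis_cnj e v"] by (simp add: m_def norm_basis_cnj [OF e])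
    then have "Re (cinner v (X *v v)) + Re (cinner m (X *v m)) \<le> (norm v)\<^sup>2 * Re (trace X)"
      using X orth by (intro norm_square_trace_ge) (simp_all add: m_def)
    \<comment> \<open>Weights in [0,1] on nonnegative terms reduce the claim to
      \<open>x = y = 1\<close>, which is the preceding estimate.\<close>
    moreover have "y * Re (cinner v (X *v v)) \<le> Re (cinner v (X *v v))"
      and "x * Re (cinner m (X *v m)) \<le> Re (cinner m (X *v m))"
      using assms(4,5) nonneg by (simp_all add: mult_left_le_one_le)
    ultimately have "Re (trace X) * (norm v)\<^sup>2 - y * Re (cinner v (X *v v)) - x * Re (cinner m (X *v m)) \<ge> 0"
      by (simp add: mult.commute)
    moreover have "cinner v (chi_map e U x y X *v v) =
      of_real (Re (trace X) * (norm v)\<^sup>2 - y * Re (cinner v (X *v v)) - x * Re (cinner m (X *v m)))"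
      unfolding chi by (subst real_tr, subst (1 2) real) simp
    ultimately show "cinner v (chi_map e U x y X *v v) \<in> \<real>\<^sub>\<ge>\<^sub>0"
      by (simp only: nonneg_Reals_of_real_iff)
  qed
  then show ?thesis
    by (simp add: positive_map_def clinear_chi_map)
qed


section \<open>States of Schmidt number at most two\<close>

text \<open>The rank is a least number of terms, so one Schmidt decomposition bounds it; here all
  coefficients are 1.\<close>

lemma schmidt_rank_le:
  assumes "orthonormal_on {..<r} u" and "orthonormal_on {..<r} v"
  shows "schmidt_rank (\<Sum>s<r. tensor_vec (u s) (v s)) \<le> r"
  unfolding schmidt_rank_def
  by (rule Least_le, rule exI [of _ "\<lambda>_. 1"], rule exI [of _ u], rule exI [of _ v])
     (use assms in simp)

text \<open>The condition minimized in \<open>schmidt_number\<close>, isolated because it is visibly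
  closed under addition, whereas a least number is awkward to handle.\<close>

definition schmidt_sum :: "nat \<Rightarrow> complex^('n::finite \<times> 'n)^('n \<times> 'n) \<Rightarrow> bool" where
  "schmidt_sum r \<rho> \<longleftrightarrow> (\<exists>N (\<psi> :: nat \<Rightarrow> complex^('n \<times> 'n)).
     (\<forall>i<N. schmidt_rank (\<psi> i) \<le> r) \<and> \<rho> = (\<Sum>i<N. outer (\<psi> i) (\<psi> i)))"

lemma schmidt_sum_outer: "schmidt_rank \<psi> \<le> r \<Longrightarrow> schmidt_sum r (outer \<psi> \<psi>)"
  unfolding schmidt_sum_def by (rule exI [of _ 1], rule exI [of _ "\<lambda>_. \<psi>"]) simp

lemma schmidt_sum_zero: "schmidt_sum r 0"
  unfolding schmidt_sum_def by (rule exI [of _ 0]) simp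

lemma schmidt_sum_add:
  fixes \<rho> \<sigma> :: "complex^('n::finite \<times> 'n)^('n \<times> 'n)"
  assumes "schmidt_sum r \<rho>" and "schmidt_sum r \<sigma>"
  shows "schmidt_sum r (\<rho> + \<sigma>)"
proof -
  obtain M and \<phi> :: "nat \<Rightarrow> complex^('n \<times> 'n)" where \<phi>: "\<forall>i<M. schmidt_rank (\<phi> i) \<le> r" "\<rho> = (\<Sum>i<M. outer (\<phi> i) (\<phi> i))"
    using assms(1) unfolding schmidt_sum_def by blast
  obtain N and \<psi> :: "nat \<Rightarrow> complex^('n \<times> 'n)" where \<psi>: "\<forall>i<N. schmidt_rank (\<psi> i) \<le> r" "\<sigma> = (\<Sum>i<N. outer (\<psi> i) (\<psi> i))"
    using assms(2) unfolding schmidt_sum_def by blast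
  define \<xi> where "\<xi> i = (if i < M then \<phi> i else \<psi> (i - M))" for i
  have "\<forall>i<M + N. schmidt_rank (\<xi> i) \<le> r"
    using \<phi>(1) \<psi>(1) by (simp add: \<xi>_def)
  moreover have "(\<Sum>i<M + n. outer (\<xi> i) (\<xi> i)) = \<rho> + (\<Sum>i<n. outer (\<psi> i) (\<psi> i))" for n
    by (induction n) (simp_all add: \<phi>(2) \<xi>_def)
  ultimately show ?thesis
    unfolding schmidt_sum_def \<psi>(2) by metis
qed

lemma schmidt_sum_sum:
  "(\<And>i. i \<in> I \<Longrightarrow> schmidt_sum r (\<rho> i)) \<Longrightarrow> schmidt_sum r (\<Sum>i\<in>I. \<rho> i)"
  by (induction I rule: infinite_finite_induct) (simp_all add: schmidt_sum_zero schmidt_sum_add)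

lemma schmidt_sum_imp_V_sub:
  assumes "schmidt_sum r \<rho>"
  shows "\<rho> \<in> V_sub r"
proof -
  have "psd \<rho>"
    using assms by (auto simp: schmidt_sum_def intro: psd_sum psd_outer)
  moreover have "schmidt_number \<rho> \<le> r"
    using assms unfolding schmidt_number_def schmidt_sum_def by (rule Least_le)
  ultimately show ?thesis
    by (simp add: V_sub_def)
qed

text \<open>Left unnormalized, so that for orthonormal \<open>a\<close>, \<open>c\<close> and
  orthonormal \<open>b\<close>, \<open>d\<close> the vector is already a Schmidt decomposition with
  both coefficients 1.\<close>

definition pair_state ::
  "complex^'n \<Rightarrow> complex^'n \<Rightarrow> complex^'n \<Rightarrow> complex^'n \<Rightarrow> complex^('n \<times> 'n)^('n \<times> 'n)" where
  "pair_state a b c d = outer (tensor_vec a b + tensor_vec c d) (tensor_vec a b + tensor_vec c d)"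

definition product_state :: "complex^'n \<Rightarrow> complex^'n \<Rightarrow> complex^('n \<times> 'n)^('n \<times> 'n)" where
  "product_state a b = outer (tensor_vec a b) (tensor_vec a b)"

text \<open>
  It is used with \<open>h = \<theta> \<circ> g\<close>, that is \<open>h = (g\<^sub>1, - g\<^sub>0, g\<^sub>3, - g\<^sub>2)\<close>. Partial transposition then turns the
  coherences between \<open>f\<^sub>i \<otimes> g\<^sub>i\<close> and \<open>f\<^sub>j \<otimes> g\<^sub>j\<close> into those between \<open>f\<^sub>i \<otimes> g\<^sub>j\<close> and
  \<open>f\<^sub>j \<otimes> g\<^sub>i\<close>, so it exchanges the roles of \<open>g\<close> and \<open>h\<close>, up to conjugation;
  the product states balance the diagonal.
\<close>

definition witness_state ::
  "(nat \<Rightarrow> complex^'n) \<Rightarrow> (nat \<Rightarrow> complex^'n) \<Rightarrow> (nat \<Rightarrow> complex^'n) \<Rightarrow> complex^('n \<times> 'n)^('n \<times> 'n)"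
  where
  "witness_state f g h =
     (\<Sum>i\<in>{0, 1}. \<Sum>j\<in>{2, 3}. pair_state (f i) (g i) (f j) (g j) + pair_state (f i) (h j) (f j) (h i)) +
     (\<Sum>i\<in>{0, 1, 2, 3}. product_state (f i) (h i) + product_state (f i) (h i))"

text \<open>A flat sum of sixteen states lets identities be checked by rewriting up to reordering.
  Repeating the product states instead of doubling them means that additivity alone carries a map
  through the sum.\<close>

lemma witness_state_expand:
  fixes f g h :: "nat \<Rightarrow> complex^'n::finite"
  shows
  "witness_state f g h =
     pair_state (f 0) (g 0) (f 2) (g 2) + pair_state (f 0) (h 2) (f 2) (h 0) +
     (pair_state (f 0) (g 0) (f 3) (g 3) + pair_state (f 0) (h 3) (f 3) (h 0)) +
     (pair_state (f 1) (g 1) (f 2) (g 2) + pair_state (f 1) (h 2) (f 2) (h 1)) +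
     (pair_state (f 1) (g 1) (f 3) (g 3) + pair_state (f 1) (h 3) (f 3) (h 1)) +
     (product_state (f 0) (h 0) + product_state (f 0) (h 0)) +
     (product_state (f 1) (h 1) + product_state (f 1) (h 1)) +
     (product_state (f 2) (h 2) + product_state (f 2) (h 2)) +
     (product_state (f 3) (h 3) + product_state (f 3) (h 3))"
proof -
  have "(\<Sum>i\<in>{0, 1, 2, 3::nat}. t i) = t 0 + t 1 + t 2 + t 3"
    "(\<Sum>i\<in>{0, 1::nat}. t i) = t 0 + t 1" "(\<Sum>i\<in>{2, 3::nat}. t i) = t 2 + t 3"
    for t :: "nat \<Rightarrow> complex^('n \<times> 'n)^('n \<times> 'n)"
    by (simp_all add: add_ac)
  then show ?thesis
    unfolding witness_state_def by (simp only: add_ac)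
qed

lemma schmidt_sum_pair_state:
  assumes "cinner a a = 1" "cinner c c = 1" "cinner a c = 0"
    and "cinner b b = 1" "cinner d d = 1" "cinner b d = 0"
  shows "schmidt_sum 2 (pair_state a b c d)"
proof -
  have swap: "cinner c a = 0" "cinner d b = 0"
    using cnj_cinner [of a c] cnj_cinner [of b d] assms by simp_all
  define u where "u s = (if s = 0 then a else c)" for s :: nat
  define v where "v s = (if s = 0 then b else d)" for s :: nat
  have "orthonormal_on {..<2} u" and "orthonormal_on {..<2} v"
    using assms swap by (auto simp: orthonormal_on_def u_def v_def)
  then have "schmidt_rank (\<Sum>s<2. tensor_vec (u s) (v s)) \<le> 2"
    by (rule schmidt_rank_le)
  then show ?thesis
    by (simp add: numeral_2_eq_2 u_def v_def pair_state_def schmidt_sum_outer)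
qed

lemma schmidt_sum_product_state:
  assumes "cinner a a = 1" "cinner b b = 1"
  shows "schmidt_sum 2 (product_state a b)"
proof -
  have "orthonormal_on {..<1} (\<lambda>_::nat. a)" and "orthonormal_on {..<1} (\<lambda>_::nat. b)"
    using assms by (simp_all add: orthonormal_on_def)
  then have "schmidt_rank (\<Sum>s<1::nat. tensor_vec a b) \<le> 1"
    by (rule schmidt_rank_le)
  then show ?thesis
    by (simp add: product_state_def schmidt_sum_outer)
qed

lemma witness_state_in_V_sub:
  assumes "orthonormal_on {..<4} f" and "orthonormal_on {..<4} g" and "orthonormal_on {..<4} h"
  shows "witness_state f g h \<in> V_sub 2"
proof -
  have on: "cinner (u i) (u j) = (if i = j then 1 else 0)" if "u \<in> {f, g, h}" "i < 4" "j < 4" for u i j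
    using that assms by (auto simp: orthonormal_on_def)
  show ?thesis
    unfolding witness_state_def
    by (intro schmidt_sum_imp_V_sub schmidt_sum_add schmidt_sum_sum schmidt_sum_pair_state
        schmidt_sum_product_state) (auto simp: on)
qed

section \<open>Partial transposition of the witness state\<close>

lemma outer_tensor_vec: "outer (tensor_vec a b) (tensor_vec c d) = tensor_mat (outer a c) (outer b d)"
  by (simp add: outer_def tensor_vec_def tensor_mat_def vec_eq_iff mult_ac)

lemma pair_state_tensor:
  "pair_state a b c d = tensor_mat (outer a a) (outer b b) + tensor_mat (outer a c) (outer b d) +
     tensor_mat (outer c a) (outer d b) + tensor_mat (outer c c) (outer d d)"
  by (simp add: pair_state_def outer_add_left outer_add_right outer_tensor_vec)

lemma product_state_tensor: "product_state a b = tensor_mat (outer a a) (outer b b)"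
  by (simp add: product_state_def outer_tensor_vec)

lemma tensor_mat_minus_right [simp]: "tensor_mat A (- B) = - tensor_mat A B"
  by (simp add: tensor_mat_def vec_eq_iff)

lemma id_tensor_add:
  assumes "clinear_map \<phi>"
  shows "id_tensor \<phi> (\<rho> + \<sigma>) = id_tensor \<phi> \<rho> + id_tensor \<phi> \<sigma>"
proof -
  interpret Vector_Spaces.linear mscale mscale \<phi> by (fact assms)
  have "(\<chi> a b. \<rho> $ (i, a) $ (j, b) + \<sigma> $ (i, a) $ (j, b)) =
      (\<chi> a b. \<rho> $ (i, a) $ (j, b)) + (\<chi> a b. \<sigma> $ (i, a) $ (j, b))" for i j
    by (simp add: vec_eq_iff)
  then have "\<phi> (\<chi> a b. \<rho> $ (i, a) $ (j, b) + \<sigma> $ (i, a) $ (j, b)) =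
      \<phi> (\<chi> a b. \<rho> $ (i, a) $ (j, b)) + \<phi> (\<chi> a b. \<sigma> $ (i, a) $ (j, b))" for i j
    by (simp add: add)
  then show ?thesis
    by (simp add: id_tensor_def vec_eq_iff)
qed

text \<open>The coherences match termwise. On the diagonal, the terms linking {0, 1} with {2, 3}
  agree because \<open>h\<close> permutes \<open>g\<close> up to sign inside each block. The
  projections onto \<open>tensor_vec (f i) (g i)\<close> and \<open>tensor_vec (f i) (h i)\<close>
  occur twice on both sides, once supplied by pair states and once by product states.\<close>

lemma id_tensor_basis_transpose_witness_state:
  assumes e: "orthonormal_on UNIV e"
    and h: "h 0 = g 1" "h 1 = - g 0" "h 2 = g 3" "h 3 = - g 2"
  shows "id_tensor (basis_transpose e)
      (witness_state f (\<lambda>i. basis_cnj e (h i)) (\<lambda>i. basis_cnj e (g i))) = witness_state f g h"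
  by (simp only: witness_state_expand pair_state_tensor product_state_tensor
      id_tensor_add [OF clinear_basis_transpose] id_tensor_tensor_mat [OF clinear_basis_transpose]
      basis_transpose_outer basis_cnj_involution [OF e])
     (simp only: h outer_minus_left outer_minus_right minus_minus tensor_mat_minus_right add_ac)

section \<open>The expectation of \<open>\<chi>\<close> in the witness state\<close>

text \<open>\<Omega> is the unnormalized maximally entangled vector of the family. The first tensor
  factor keeps only the summands \<open>i = k\<close> and \<open>j = l\<close>, so expectations in
  \<Omega> become matrix elements of the second factor.\<close>

lemma cinner_tensor_mat:
  fixes v :: "nat \<Rightarrow> complex^'n"
  assumes v: "orthonormal_on {..<n} v" and "k < n" "l < n"
  defines "\<Omega> \<equiv> \<Sum>i<n. tensor_vec (v i) (v i)"
  shows "cinner \<Omega> (tensor_mat (outer (v k) (v l)) B *v \<Omega>) = cinner (v k) (B *v v l)"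
proof -
  have tensor: "tensor_mat A B *v tensor_vec a b = tensor_vec (A *v a) (B *v b)" for A a b
    by (simp add: tensor_mat_def tensor_vec_def matrix_vector_mult_def vec_eq_iff
        UNIV_Times_UNIV [symmetric] sum.cartesian_product' sum_product mult_ac
        del: UNIV_Times_UNIV)
  have inner: "cinner (tensor_vec a b) (tensor_vec c d) = cinner a c * cinner b d" for a b c d :: "complex^'n"
    by (simp add: cinner_def tensor_vec_def UNIV_Times_UNIV [symmetric] sum.cartesian_product'
        sum_product mult_ac del: UNIV_Times_UNIV)
  have on: "cinner (v i) (v j) = (if i = j then 1 else 0)" if "i < n" "j < n" for i j
    using v that by (simp add: orthonormal_on_def)
  have "cinner \<Omega> (tensor_mat (outer (v k) (v l)) B *v \<Omega>) =
      (\<Sum>i<n. \<Sum>j<n. cinner (v l) (v j) * cinner (v i) (v k) * cinner (v i) (B *v v j))"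
    unfolding \<Omega>_def
    by (simp add: matrix_vector_mult_sum cinner_sum_left cinner_sum_right tensor inner outer_mult_vec)
       (rule sum.swap)
  also have "\<dots> = (\<Sum>i<n. \<Sum>j<n. if j = l then if i = k then cinner (v i) (B *v v j) else 0 else 0)"
    using assms(2,3) by (intro sum.cong refl) (auto simp: on)
  also have "\<dots> = cinner (v k) (B *v v l)"
    using assms(2,3) by simp
  finally show ?thesis .
qed

lemma witness_expectation:
  assumes v: "orthonormal_on {..<4} v"
    and \<theta>: "\<And>a. \<theta> a = U *v basis_cnj e a"
    and anti: "\<And>a b. cinner a (\<theta> b) = - cinner b (\<theta> a)"
    and iso: "cinner (v 3) (\<theta> (v 1)) = 0"
    and v1: "v 1 = \<theta> (v 0)" and v3: "v 3 = \<theta> (v 2)"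
    and h: "h 0 = v 1" "h 1 = - v 0" "h 2 = v 3" "h 3 = - v 2"
  defines "\<Omega> \<equiv> \<Sum>i<4::nat. tensor_vec (v i) (v i)"
  shows "cinner \<Omega> (id_tensor (chi_map e U x y) (witness_state v v h) *v \<Omega>) =
    of_real (24 - 16 * (x + y))"
proof -
  have \<Omega>: "cinner \<Omega> (tensor_mat (outer (v k) (v l)) B *v \<Omega>) = cinner (v k) (B *v v l)"
    if "k < 4" "l < 4" for k l B
    unfolding \<Omega>_def using v that by (rule cinner_tensor_mat)
  have on: "cinner (v i) (v j) = (if i = j then 1 else 0)" if "i < 4" "j < 4" for i j
    using v that by (simp add: orthonormal_on_def)
  \<comment> \<open>The matrix of \<theta> in the frame: columns 0 and 2 are given by
    \<open>v1\<close> and \<open>v3\<close>, antisymmetry yields rows 0 and 2 and the zero diagonal,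
    and \<open>iso\<close> covers the entries (3,1) and (1,3).\<close>
  have gram: "cinner (v i) (\<theta> (v 0)) = (if i = 1 then 1 else 0)"
    "cinner (v i) (\<theta> (v 2)) = (if i = 3 then 1 else 0)" if "i < 4" for i
    using that by (simp_all add: v1 [symmetric] v3 [symmetric] on)
  have gram': "cinner (v 0) (\<theta> (v i)) = (if i = 1 then - 1 else 0)"
    "cinner (v 2) (\<theta> (v i)) = (if i = 3 then - 1 else 0)" if "i < 4" for i
    using gram [OF that] by (simp_all add: anti [of "v 0"] anti [of "v 2"])
  have self: "cinner a (\<theta> a) = 0" for a
    using anti [of a a] by simp
  have iso': "cinner (v 1) (\<theta> (v 3)) = 0"
    using anti [of "v 1" "v 3"] iso by simp
  have left: "cinner (\<theta> a) b = cnj (cinner b (\<theta> a))" for a b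
    by (simp add: cnj_cinner)
  have minus: "\<theta> (- a) = - \<theta> a" for a
    by (simp add: \<theta> matrix_vector_mult_uminus)
  have chi: "cinner u (chi_map e U x y (outer a b) *v w) =
    cinner b a * cinner u w - y * (cinner u a * cinner b w) - x * (cinner u (\<theta> b) * cinner (\<theta> a) w)"
    for u a b w
    by (simp add: cinner_chi_map_outer \<theta>)
  note lin = id_tensor_add [OF clinear_chi_map] id_tensor_tensor_mat [OF clinear_chi_map]
  have pair: "cinner \<Omega> (id_tensor (chi_map e U x y) (pair_state (v i) a (v j) b) *v \<Omega>) =
      cinner (v i) (chi_map e U x y (outer a a) *v v i) + cinner (v i) (chi_map e U x y (outer a b) *v v j) +
      cinner (v j) (chi_map e U x y (outer b a) *v v i) + cinner (v j) (chi_map e U x y (outer b b) *v v j)"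
    if "i < 4" "j < 4" for i j a b
    using that by (simp add: pair_state_tensor lin matrix_vector_mult_add_rdistrib cinner_add_right \<Omega>)
  have product: "cinner \<Omega> (id_tensor (chi_map e U x y) (product_state (v i) a) *v \<Omega>) =
      cinner (v i) (chi_map e U x y (outer a a) *v v i)" if "i < 4" for i a
    using that by (simp add: product_state_tensor lin \<Omega>)
  let ?E = "\<lambda>\<rho>. cinner \<Omega> (id_tensor (chi_map e U x y) \<rho> *v \<Omega>)"
  note eval_simps = chi left minus on gram gram' self iso iso'
  \<comment> \<open>Each diagonal term gives \<open>1 - y\<close> and each coherence
    \<open>- y\<close>; \<theta> has no matrix elements between the two blocks.\<close>
  have "?E (pair_state (v i) (v i) (v j) (v j)) = of_real (2 - 4 * y)"
    if "i \<in> {0, 1}" "j \<in> {2, 3}" for i j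
    using that by (auto simp: pair eval_simps simp del: One_nat_def)
  \<comment> \<open>Now the diagonal terms give 1 and the coherences \<open>- x\<close>, because
    \<open>cinner (v i) (\<theta> (h i)) = - 1\<close>.\<close>
  moreover have "?E (pair_state (v i) (h j) (v j) (h i)) = of_real (2 - 2 * x)"
    if "i \<in> {0, 1}" "j \<in> {2, 3}" for i j
    using that by (auto simp: pair h eval_simps simp del: One_nat_def)
  moreover have "?E (product_state (v i) (h i)) = of_real (1 - x)" if "i \<in> {0, 1, 2, 3}" for i
    using that by (auto simp: product h eval_simps simp del: One_nat_def)
  \<comment> \<open>There are four pairs of indices for either kind of pair state, and four product
    states counted twice.\<close>
  ultimately have "?E (witness_state v v h) =
      4 * of_real (2 - 4 * y) + 4 * of_real (2 - 2 * x) + 8 * of_real (1 - x)"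
    by (simp only: witness_state_expand lin(1) matrix_vector_mult_add_rdistrib cinner_add_right
        insert_iff simp_thms)
       simp
  then show ?thesis
    by simp
qed

section \<open>Symplectic frames\<close>

context
  fixes e :: "'n::finite \<Rightarrow> complex^'n" and S \<Sigma> U
  assumes e: "orthonormal_on UNIV e" and \<Sigma>: "\<Sigma> = vec.span (e ` S)"
    and U: "basis_transpose e U = - U" "unitary_on \<Sigma> U" "zero_on_orthogonal \<Sigma> U"
begin

text \<open>\<Sigma> is spanned by basis vectors, so membership means vanishing coordinates outside
  \<open>S\<close>, which conjugation preserves.\<close>

lemma basis_cnj_mem: "v \<in> \<Sigma> \<Longrightarrow> basis_cnj e v \<in> \<Sigma>"
proof -
  assume v: "v \<in> \<Sigma>"
  have zero: "cinner (e i) v = 0" if "i \<notin> S" for i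
    using v unfolding \<Sigma>
  proof (induction rule: vec.span_induct_alt)
    case base
    show ?case by simp
  next
    case (step c a w)
    then show ?case
      using that e by (auto simp: cinner_add_right orthonormal_on_def split: if_splits)
  qed
  have "cnj (cinner (e i) v) *s e i \<in> \<Sigma>" for i
    by (cases "i \<in> S") (auto simp: zero \<Sigma> vec.span_zero intro: vec.span_scale vec.span_base)
  then show ?thesis
    unfolding basis_cnj_def \<Sigma> by (intro vec.span_sum)
qed

text \<open>Split \<open>z\<close> into its component \<open>p\<close> in \<Sigma>, on which
  \<open>U\<close> is isometric, and the orthogonal rest \<open>q\<close>, which \<open>U\<close>
  kills; Pythagoras concludes.\<close>

lemma norm_contraction: "norm (U *v z) \<le> norm z"
proof -
  define p where "p = (\<Sum>i\<in>S. cinner (e i) z *s e i)"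
  define q where "q = (\<Sum>i\<in>- S. cinner (e i) z *s e i)"
  have z: "z = p + q"
    unfolding p_def q_def using basis_expansion [OF e, of z]
    by (simp add: sum.union_disjoint [symmetric] Compl_partition)
  have p: "p \<in> \<Sigma>"
    unfolding p_def \<Sigma> by (intro vec.span_sum vec.span_scale vec.span_base imageI)
  have q: "cinner w q = 0" if "w \<in> \<Sigma>" for w
    using that unfolding \<Sigma>
  proof (induction rule: vec.span_induct_alt)
    case base
    show ?case by simp
  next
    case (step c a w)
    have "cinner a q = 0"
      unfolding q_def cinner_sum_right
      using step(1) e by (intro sum.neutral) (auto simp: orthonormal_on_def split: if_splits)
    with step show ?case
      by (simp add: cinner_add_left)
  qed
  have "U *v q = 0"
    using U(3) q by (simp add: zero_on_orthogonal_def)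
  then have "cinner (U *v z) (U *v z) = cinner p p"
    using U(2) p by (simp add: z matrix_vector_right_distrib unitary_on_def)
  moreover have "cinner q p = 0"
    using q [OF p] cnj_cinner [of p q] by simp
  then have "cinner z z = cinner p p + cinner q q"
    using q [OF p] by (simp add: z cinner_add_left cinner_add_right)
  ultimately have "complex_of_real ((norm z)\<^sup>2) = complex_of_real ((norm (U *v z))\<^sup>2 + (norm q)\<^sup>2)"
    by (simp only: cinner_self of_real_add)
  then have "(norm (U *v z))\<^sup>2 \<le> (norm z)\<^sup>2"
    by (simp only: of_real_eq_iff) simp
  then show ?thesis
    by (rule power2_le_imp_le) simp
qed

text \<open>On \<Sigma> the map \<theta> is antiunitary and antisymmetric. Hence for unit vectors
  \<open>p\<close> and \<open>q\<close> in \<Sigma> with \<open>q\<close> orthogonal to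
  \<open>p\<close> and \<theta> p, the four vectors p, \<theta> p, q, \<theta> q are
  orthonormal.\<close>

lemma symplectic_frame:
  assumes dim: "vec.dim \<Sigma> \<ge> 4"
  obtains v :: "nat \<Rightarrow> complex^'n" where "orthonormal_on {..<4} v"
    and "v 1 = U *v basis_cnj e (v 0)" and "v 3 = U *v basis_cnj e (v 2)"
    and "cinner (v 3) (U *v basis_cnj e (v 1)) = 0"
proof -
  define \<theta> where "\<theta> v = U *v basis_cnj e v" for v
  have mem: "\<theta> v \<in> \<Sigma>" if "v \<in> \<Sigma>" for v
    using U(2) basis_cnj_mem [OF that] by (auto simp: unitary_on_def \<theta>_def)
  have conj: "cinner (\<theta> v) (\<theta> w) = cinner w v" if "v \<in> \<Sigma>" "w \<in> \<Sigma>" for v w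
    using U(2) basis_cnj_mem [OF that(1)] basis_cnj_mem [OF that(2)]
    by (simp add: unitary_on_def \<theta>_def cinner_basis_cnj_cnj [OF e])
  have anti: "cinner a (\<theta> b) = - cinner b (\<theta> a)" for a b
    unfolding \<theta>_def by (rule cinner_antisymmetric [OF e U(1)])
  have self: "cinner a (\<theta> a) = 0" for a
    using anti [of a a] by simp
  \<comment> \<open>One Gram-Schmidt step against at most two vectors. Allowing zero vectors lets it
    produce both \<open>p\<close>, from \<open>a = b = 0\<close>, and \<open>q\<close>.\<close>
  have unit: "\<exists>w\<in>\<Sigma>. cinner w w = 1 \<and> cinner a w = 0 \<and> cinner b w = 0"
    if "a \<in> \<Sigma>" "b \<in> \<Sigma>" "cinner a a = 1 \<or> a = 0" "cinner b b = 1 \<or> b = 0" "cinner a b = 0" for a b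
  proof -
    have "\<not> \<Sigma> \<subseteq> vec.span {a, b}"
    proof
      assume "\<Sigma> \<subseteq> vec.span {a, b}"
      then have "vec.dim \<Sigma> \<le> card {a, b}"
        by (rule vec.dim_le_card) simp
      also have "card {a, b} \<le> 2"
        by (simp add: card_insert_if)
      finally show False
        using dim by simp
    qed
    then obtain s where s: "s \<in> \<Sigma>" "s \<notin> vec.span {a, b}"
      by blast
    define t where "t = s - (cinner a s *s a + cinner b s *s b)"
    have "cinner a s *s a + cinner b s *s b \<in> vec.span {a, b}"
      by (intro vec.span_add vec.span_scale vec.span_base) simp_all
    then have t: "t \<noteq> 0"
      using s(2) by (auto simp: t_def)
    have "cinner b a = 0"
      using cnj_cinner [of a b] that(5) by simp
    then have orth: "cinner a t = 0" "cinner b t = 0"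
      using that(3-5) by (auto simp: t_def cinner_add_right cinner_diff_right)
    have "t \<in> \<Sigma>"
      using s(1) that(1,2) unfolding t_def \<Sigma>
      by (intro vec.span_diff vec.span_add vec.span_scale)
    then have "complex_of_real (inverse (norm t)) *s t \<in> \<Sigma>"
      unfolding \<Sigma> by (rule vec.span_scale)
    moreover have "cinner (complex_of_real (inverse (norm t)) *s t) (complex_of_real (inverse (norm t)) *s t) = 1"
      using t by (rule cinner_normalize)
    ultimately show ?thesis
      using orth by (intro bexI [of _ "complex_of_real (inverse (norm t)) *s t"]) simp_all
  qed
  have "0 \<in> \<Sigma>"
    by (simp add: \<Sigma> vec.span_zero)
  then obtain p where p: "p \<in> \<Sigma>" "cinner p p = 1"
    using unit [of 0 0] by auto
  obtain q where q: "q \<in> \<Sigma>" "cinner q q = 1" "cinner p q = 0" "cinner (\<theta> p) q = 0"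
    using unit [of p "\<theta> p"] p mem [OF p(1)] conj [OF p(1) p(1)] self [of p] by auto
  define v where "v i = [p, \<theta> p, q, \<theta> q] ! i" for i
  have v: "v 0 = p" "v 1 = \<theta> p" "v 2 = q" "v 3 = \<theta> q"
    by (simp_all add: v_def)
  have sym: "cinner b a = 0" if "cinner a b = 0" for a b :: "complex^'n"
    using cnj_cinner [of a b] that by simp
  have rels: "cinner p (\<theta> q) = 0" "cinner (\<theta> p) (\<theta> q) = 0" "cinner (\<theta> p) (\<theta> p) = 1"
    "cinner (\<theta> q) (\<theta> q) = 1" "cinner q (\<theta> p) = 0"
    using anti [of p q] sym [OF q(4)] sym [OF q(3)] conj p q by simp_all
  have set4: "{..<4} = {0, 1, 2, 3::nat}"
    by auto
  have "orthonormal_on {..<4} v"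
    unfolding orthonormal_on_def set4
    by (simp add: v p q rels self sym [OF self] sym [OF rels(1)] sym [OF rels(2)] sym [OF q(3)]
        del: One_nat_def)
  \<comment> \<open>Antiunitarity turns this into \<open>cinner (\<theta> p) q\<close>.\<close>
  moreover have "cinner (\<theta> q) (\<theta> (\<theta> p)) = 0"
    using conj [OF q(1) mem [OF p(1)]] q(4) by simp
  ultimately show thesis
    by (intro that [of v]) (simp_all add: v \<theta>_def [symmetric] del: One_nat_def)
qed

end

section \<open>Positivity and atomicity of \<chi>\<close>

theorem theorem5:
  fixes e :: "'n::finite \<Rightarrow> complex^'n"
    and \<Sigma> :: "(complex^'n) set"
    and S :: "'n set"
    and U :: "complex^'n^'n"
    and x y :: real
  assumes "CARD('n) \<ge> 4"
    and "vec.subspace \<Sigma>" and "even (vec.dim \<Sigma>)" and "vec.dim \<Sigma> \<ge> 4"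
    and "orthonormal_on UNIV e" and "\<Sigma> = vec.span (e ` S)"
    and "basis_transpose e U = - U" and "unitary_on \<Sigma> U" and "zero_on_orthogonal \<Sigma> U"
    and "x \<in> {0..1}" and "y \<in> {0..1}" and "x + y > 7 / 4"
  shows "atomic_map e (chi_map e U x y)"
proof -
  note frame_assms = assms(5-9)
  have pos: "positive_map (chi_map e U x y)"
    using assms(5,7,10,11) norm_contraction [OF frame_assms] by (intro positive_chi_map)
  obtain v :: "nat \<Rightarrow> complex^'n" where v: "orthonormal_on {..<4} v"
    "v 1 = U *v basis_cnj e (v 0)" "v 3 = U *v basis_cnj e (v 2)"
    "cinner (v 3) (U *v basis_cnj e (v 1)) = 0"
    using symplectic_frame [OF frame_assms assms(4)] by blast
  \<comment> \<open>The image of the frame under \<theta>, using that \<theta> squares to -1 on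
    \<Sigma>.\<close>
  define h where "h i = [v 1, - v 0, v 3, - v 2] ! i" for i
  have h: "h 0 = v 1" "h 1 = - v 0" "h 2 = v 3" "h 3 = - v 2"
    by (simp_all add: h_def)
  have set4: "{..<4} = {0, 1, 2, 3::nat}"
    by auto
  have on_h: "orthonormal_on {..<4} h"
    using v(1) unfolding orthonormal_on_def set4 by (simp add: h del: One_nat_def)
  have on_cnj: "orthonormal_on {..<4} (\<lambda>i. basis_cnj e (u i))" if "orthonormal_on {..<4} u" for u :: "nat \<Rightarrow> _"
    using that by (simp add: orthonormal_on_def cinner_basis_cnj_cnj [OF assms(5)])
  define \<rho> where "\<rho> = witness_state v v h"
  have V_sub: "\<rho> \<in> V_sub 2"
    unfolding \<rho>_def using v(1) v(1) on_h by (rule witness_state_in_V_sub)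
  \<comment> \<open>The preimage of \<rho> is again a witness state of orthonormal families, hence
    in \<open>V_sub 2\<close>; so \<rho> lies in \<open>V_sub 2\<close> and in
    \<open>V_sup e 2\<close>.\<close>
  have "id_tensor (basis_transpose e) (witness_state v (\<lambda>i. basis_cnj e (h i)) (\<lambda>i. basis_cnj e (v i))) = \<rho>"
    unfolding \<rho>_def by (rule id_tensor_basis_transpose_witness_state [OF assms(5) h])
  moreover have "witness_state v (\<lambda>i. basis_cnj e (h i)) (\<lambda>i. basis_cnj e (v i)) \<in> V_sub 2"
    using v(1) on_cnj [OF on_h] on_cnj [OF v(1)] by (rule witness_state_in_V_sub)
  ultimately have V_sup: "\<rho> \<in> V_sup e 2"
    unfolding V_sup_def by blast
  define \<Omega> where "\<Omega> = (\<Sum>i<4::nat. tensor_vec (v i) (v i))"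
  have expectation: "cinner \<Omega> (id_tensor (chi_map e U x y) \<rho> *v \<Omega>) = of_real (24 - 16 * (x + y))"
    unfolding \<Omega>_def \<rho>_def
    using v(1) refl cinner_antisymmetric [OF assms(5,7)] v(4) v(2) v(3) h by (rule witness_expectation)
  have False if "\<phi> \<in> P_sub 2" "\<psi> \<in> P_sup e 2" "chi_map e U x y = (\<lambda>X. \<phi> X + \<psi> X)" for \<phi> \<psi>
  proof -
    have "id_tensor (chi_map e U x y) \<rho> = id_tensor \<phi> \<rho> + id_tensor \<psi> \<rho>"
      by (simp add: that(3) id_tensor_def vec_eq_iff)
    moreover have "psd (id_tensor \<phi> \<rho>)" and "psd (id_tensor \<psi> \<rho>)"
      using that V_sub V_sup by (simp_all add: P_sub_def P_sup_def)
    ultimately have "psd (id_tensor (chi_map e U x y) \<rho>)"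
      by (simp add: psd_add)
    \<comment> \<open>Positivity tested at \<Omega>; for \<open>x + y > 7 / 4\<close> the value is
      below -4.\<close>
    then have "24 - 16 * (x + y) \<ge> 0"
      unfolding psd_def using expectation by (metis nonneg_Reals_of_real_iff)
    then show False
      using assms(12) by simp
  qed
  then show ?thesis
    unfolding atomic_map_def using pos by blast
qed

end
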